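(* Let $a\leq b$ be even positive integers and let $n=ab$. Then $\mathrm{MiD}(L_{a,b})\geq\frac{n-a}{2}$.
   Context: A Latin square of order $n$ is an $n\times n$ array with entries from $\{1,2,\dots,n\}$ such that each row and each column contains every symbol exactly once. For positive integers $a,b$ and $n=ab$, an $(a,b)$-Sudoku Latin square is a Latin square of order $n$ such that, when the array is tiled by $a\times b$ blocks ($a$ consecutive rows $ka+1,\dots,(k+1)a$ by $b$ consecutive columns $lb+1,\dots,(l+1)b$), each block contains every symbol of $\{1,\dots,n\}$ exactly once. Two cells are adjacent if they share an edge horizontally or vertically (no wrap-around). The distance between two adjacent cells containing symbols $u,v$ is $\min\{(u-v)\bmod n,\ (v-u)\bmod n\}$, residues being taken in $\{0,\dots,n-1\}$. The inner distance of a Latin square of order $n\ge2$ is the minimum of the distances over all pairs of adjacent cells. $\mathrm{MiD}(L_{a,b})$ denotes the maximum of the inner distances of all $(a,b)$-Sudoku Latin squares. *)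

theory Defs
  imports Complex_Main
begin

text \<open>
  An array of order n is a function on row and column indices; only its values at indices
  in {1..n} matter in the definitions below.
\<close>

definition latin_square :: "nat \<Rightarrow> (nat \<Rightarrow> nat \<Rightarrow> nat) \<Rightarrow> bool" where
  "latin_square n L \<longleftrightarrow>
     (\<forall>i\<in>{1..n}. bij_betw (\<lambda>j. L i j) {1..n} {1..n}) \<and>
     (\<forall>j\<in>{1..n}. bij_betw (\<lambda>i. L i j) {1..n} {1..n})"

text \<open>
  Blocks have a rows and b columns, so there are b bands of rows (index k) and a stacks of
  columns (index l).
\<close>

definition sudoku_latin_square :: "nat \<Rightarrow> nat \<Rightarrow> (nat \<Rightarrow> nat \<Rightarrow> nat) \<Rightarrow> bool" where
  "sudoku_latin_square a b L \<longleftrightarrow>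
     latin_square (a * b) L \<and>
     (\<forall>k<b. \<forall>l<a. bij_betw (\<lambda>(i, j). L i j)
        ({k * a + 1..(k + 1) * a} \<times> {l * b + 1..(l + 1) * b}) {1..a * b})"

definition adjacent_cells :: "nat \<times> nat \<Rightarrow> nat \<times> nat \<Rightarrow> bool" where
  "adjacent_cells c d \<longleftrightarrow>
     (fst c = fst d \<and> (snd d = snd c + 1 \<or> snd c = snd d + 1)) \<or>
     (snd c = snd d \<and> (fst d = fst c + 1 \<or> fst c = fst d + 1))"

definition cyclic_distance :: "nat \<Rightarrow> nat \<Rightarrow> nat \<Rightarrow> int" where
  "cyclic_distance n u v = min ((int u - int v) mod int n) ((int v - int u) mod int n)"

text \<open>
  The set below is finite, and nonempty as soon as n is at least 2; for smaller n there are
  no adjacent cells and the value is meaningless.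
\<close>

definition inner_distance :: "nat \<Rightarrow> (nat \<Rightarrow> nat \<Rightarrow> nat) \<Rightarrow> int" where
  "inner_distance n L =
     Min {cyclic_distance n (L i j) (L i' j') | i j i' j'.
       i \<in> {1..n} \<and> j \<in> {1..n} \<and> i' \<in> {1..n} \<and> j' \<in> {1..n} \<and>
       adjacent_cells (i, j) (i', j')}"

text \<open>
  For n = a * b at least 2 every inner distance lies in {0..<n}, so the maximum ranges over
  a finite set although there are infinitely many functions representing each array.
\<close>

definition MiD :: "nat \<Rightarrow> nat \<Rightarrow> int" where
  "MiD a b = Max {inner_distance (a * b) L | L. sudoku_latin_square a b L}"

end

theory Submission
  imports Defs "HOL-Number_Theory.Cong"
begin

text \<open>
  Write \<open>a = 2 * h\<close> and \<open>m = h * b\<close>, so that \<open>n = 2 * m\<close>. The bound says that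
  the symbols of adjacent cells differ modulo \<open>n\<close> by some \<open>d\<close> with
  \<open>m - h \<le> d \<le> m + h\<close>. The witness is a sum \<open>r x + c y\<close> modulo \<open>n\<close>
  of a row offset and a column offset, so vertical steps depend on \<open>r\<close> alone and horizontal
  steps on \<open>c\<close> alone.

  The row offsets run through \<open>0, m, 1, m + 1, 2, m + 2, \<dots>\<close>, with steps \<open>m\<close> and
  \<open>m + 1\<close>. Hence a band of \<open>a\<close> rows collects the offsets
  \<open>{s, \<dots>, s + h - 1} + {0, m}\<close>. A stack of \<open>b\<close> columns completes this to a tiling
  of the residues modulo \<open>n\<close> as soon as its offsets are, modulo \<open>m\<close>, a translate of the
  multiples of \<open>h\<close>. The column step \<open>m - h = h * (b - 1)\<close> achieves this, as
  \<open>b - 1\<close> is coprime to \<open>b\<close>. Because \<open>b\<close> is even,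
  \<open>b - 1\<close> is coprime to \<open>2 * b\<close> as well, so \<open>2 * b\<close> columns with
  this step exhaust a coset of the multiples of \<open>h\<close>. After each such run one step is
  lengthened to \<open>m - h + 1\<close>, which moves to the next of the \<open>h\<close> cosets.

  Injectivity is always obtained by decoding: a small modulus (\<open>h\<close>, or \<open>m\<close> for rows
  alone) leaves only the slow parts \<open>x div 2\<close> and \<open>y div (2 * b)\<close>, and once they are
  known the remaining multiples of \<open>h\<close> can be cancelled
  (\<open>inj_row_offset\<close>, \<open>inj_column_offset\<close>, \<open>inj_offset_sum_block\<close>). The steps are
  bounded in \<open>cyclic_distance_adjacent_ge\<close>.
\<close>

section \<open>The offsets\<close>

text \<open>
  Rows and columns are counted from zero here. Since \<open>2 * (h * b)\<close> vanishes modulo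
  \<open>n\<close>, the term \<open>x * (h * b)\<close> depends only on the parity of \<open>x\<close>, and
  likewise \<open>y * (h * (b - 1))\<close> only on \<open>y mod (2 * b)\<close>; not reducing these factors
  makes the steps between neighbours visible.
\<close>

definition row_offset :: "nat \<Rightarrow> nat \<Rightarrow> nat \<Rightarrow> nat" where
  "row_offset h b x = x div 2 + x * (h * b)"

definition column_offset :: "nat \<Rightarrow> nat \<Rightarrow> nat \<Rightarrow> nat" where
  "column_offset h b y = y div (2 * b) + y * (h * (b - 1))"

definition offset_square :: "nat \<Rightarrow> nat \<Rightarrow> nat \<Rightarrow> nat \<Rightarrow> nat" where
  "offset_square h b i j =
     1 + (row_offset h b (i - 1) + column_offset h b (j - 1)) mod (2 * h * b)"

lemma cong_less_imp_eq:
  fixes x y k :: nat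
  assumes "[x = y] (mod k)" "x < k" "y < k"
  shows "x = y"
  using assms by (simp add: cong_def)

lemma eq_if_div_eq_cong:
  fixes x y k :: nat
  assumes "x div k = y div k" "[x = y] (mod k)"
  shows "x = y"
  using assms by (metis cong_def div_mult_mod_eq)

lemma cong_mult_cancel_scaled:
  fixes x y g u k :: nat
  assumes "[x * (g * u) = y * (g * u)] (mod g * k)" "0 < g" "coprime u k"
  shows "[x = y] (mod k)"
proof -
  have "(g * (x * u)) mod (g * k) = (g * (y * u)) mod (g * k)"
    using assms(1) by (simp add: cong_def mult_ac)
  hence "g * ((x * u) mod k) = g * ((y * u) mod k)"
    by (simp only: mult_mod_right)
  hence "[x * u = y * u] (mod k)" using assms(2) by (simp add: cong_def)
  thus ?thesis using assms(3) by (simp add: cong_mult_rcancel_nat)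
qed

lemma coprime_pred_double:
  fixes b :: nat
  assumes "0 < b" "even b"
  shows "coprime (b - 1) (2 * b)"
proof -
  have "coprime (b - 1) b" using assms(1) by (rule coprime_diff_one_left_nat)
  moreover have "coprime (b - 1) 2" using assms by simp
  ultimately show ?thesis by simp
qed

lemma inj_row_offset:
  assumes "[row_offset h b x = row_offset h b x'] (mod 2 * h * b)"
    and "x < 2 * h * b" "x' < 2 * h * b"
  shows "x = x'"
proof -
  have pos: "0 < h * b" using assms(2) by (cases "h * b = 0") auto
  have "[row_offset h b x = row_offset h b x'] (mod h * b)"
    by (rule cong_dvd_modulus_nat[OF assms(1)]) simp
  hence "[x div 2 = x' div 2] (mod h * b)" by (simp add: row_offset_def cong_def)
  hence slow: "x div 2 = x' div 2"
    by (rule cong_less_imp_eq) (use assms(2,3) in auto)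
  \<comment> \<open>The row case of the scaled cancellation has unit multiplier \<open>1\<close>.\<close>
  have "[x * (h * b * 1) = x' * (h * b * 1)] (mod (h * b) * 2)"
    using assms(1) slow by (simp add: row_offset_def cong_add_lcancel_nat mult_ac)
  hence "[x = x'] (mod 2)" by (rule cong_mult_cancel_scaled) (use pos in auto)
  with slow show ?thesis by (rule eq_if_div_eq_cong)
qed

lemma inj_column_offset:
  assumes "[column_offset h b y = column_offset h b y'] (mod 2 * h * b)"
    and "y < 2 * h * b" "y' < 2 * h * b" "even b"
  shows "y = y'"
proof -
  have pos: "0 < h" "0 < b" using assms(2) by (cases "h = 0"; cases "b = 0"; simp)+
  have "[column_offset h b y = column_offset h b y'] (mod h)"
    by (rule cong_dvd_modulus_nat[OF assms(1)]) simp
  moreover have "y * (h * (b - 1)) = h * (y * (b - 1))" for y by simp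
  ultimately have "[y div (2 * b) = y' div (2 * b)] (mod h)"
    unfolding column_offset_def cong_def by (metis mod_mult_self2)
  hence slow: "y div (2 * b) = y' div (2 * b)"
    by (rule cong_less_imp_eq) (use assms(2,3) pos in
        \<open>auto simp: less_mult_imp_div_less mult_ac\<close>)
  have "[y * (h * (b - 1)) = y' * (h * (b - 1))] (mod h * (2 * b))"
    using assms(1) slow by (simp add: column_offset_def cong_add_lcancel_nat mult_ac)
  hence "[y = y'] (mod 2 * b)"
    by (rule cong_mult_cancel_scaled) (use pos assms(4) coprime_pred_double in auto)
  with slow show ?thesis by (rule eq_if_div_eq_cong)
qed

text \<open>
  Within a block the column part \<open>y div (2 * b)\<close> is constant, because a run of
  \<open>2 * b\<close> columns consists of two whole stacks. So reduction modulo \<open>h\<close> reveals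
  \<open>x div 2\<close>, reduction modulo \<open>h * b\<close> then reveals \<open>y\<close>, and the full
  congruence finally the parity of \<open>x\<close>.
\<close>

lemma inj_offset_sum_block:
  assumes cong: "[row_offset h b x + column_offset h b y =
      row_offset h b x' + column_offset h b y'] (mod 2 * h * b)"
    and band: "x div (2 * h) = x' div (2 * h)" and stack: "y div b = y' div b"
    and pos: "0 < h" "0 < b"
  shows "x = x' \<and> y = y'"
proof -
  have q: "y div (2 * b) = y' div (2 * b)"
    using stack by (metis div_mult2_eq mult.commute)
  have rest: "[x div 2 + (x * (h * b) + y * (h * (b - 1))) =
      x' div 2 + (x' * (h * b) + y' * (h * (b - 1)))] (mod 2 * h * b)"
  proof -
    have "[y div (2 * b) + (x div 2 + (x * (h * b) + y * (h * (b - 1)))) =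
      y div (2 * b) + (x' div 2 + (x' * (h * b) + y' * (h * (b - 1))))] (mod 2 * h * b)"
      using cong q by (simp add: row_offset_def column_offset_def add_ac)
    thus ?thesis by (simp only: cong_add_lcancel_nat)
  qed
  have "[x div 2 + (x * (h * b) + y * (h * (b - 1))) =
      x' div 2 + (x' * (h * b) + y' * (h * (b - 1)))] (mod h)"
    by (rule cong_dvd_modulus_nat[OF rest]) simp
  moreover have "x * (h * b) + y * (h * (b - 1)) = h * (x * b + y * (b - 1))" for x y
    by (simp add: algebra_simps)
  ultimately have "[x div 2 = x' div 2] (mod h)"
    unfolding cong_def by (metis mod_mult_self2)
  moreover have "x div 2 div h = x' div 2 div h" using band by (simp add: div_mult2_eq)
  ultimately have s: "x div 2 = x' div 2" using eq_if_div_eq_cong by blast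
  have rest2: "[x * (h * b) + y * (h * (b - 1)) =
      x' * (h * b) + y' * (h * (b - 1))] (mod 2 * h * b)"
    using rest s by (simp add: cong_add_lcancel_nat)
  have "[x * (h * b) + y * (h * (b - 1)) =
      x' * (h * b) + y' * (h * (b - 1))] (mod h * b)"
    by (rule cong_dvd_modulus_nat[OF rest2]) simp
  hence "[y * (h * (b - 1)) = y' * (h * (b - 1))] (mod h * b)"
    by (simp add: cong_def)
  hence "[y = y'] (mod b)"
    by (rule cong_mult_cancel_scaled) (use pos coprime_diff_one_left_nat in auto)
  hence y: "y = y'" using stack eq_if_div_eq_cong by blast
  have "[x * (h * b * 1) = x' * (h * b * 1)] (mod (h * b) * 2)"
    using rest2 y by (simp add: cong_add_rcancel_nat mult_ac)
  hence "[x = x'] (mod 2)" by (rule cong_mult_cancel_scaled) (use pos in auto)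
  with s have "x = x'" by (rule eq_if_div_eq_cong)
  thus ?thesis using y by simp
qed

section \<open>The Sudoku Latin square\<close>

lemma offset_square_eq_iff:
  "offset_square h b i j = offset_square h b i' j' \<longleftrightarrow>
    [row_offset h b (i - 1) + column_offset h b (j - 1) =
     row_offset h b (i' - 1) + column_offset h b (j' - 1)] (mod 2 * h * b)"
  by (simp add: offset_square_def cong_def)

lemma offset_square_in_range:
  assumes "0 < h" "0 < b"
  shows "offset_square h b i j \<in> {1..2 * h * b}"
  using assms by (simp add: offset_square_def Suc_le_eq)

lemma bij_betw_if_inj_on_card_eq:
  assumes "inj_on f A" "f ` A \<subseteq> B" "finite B" "card A = card B"
  shows "bij_betw f A B"
  using assms by (simp add: bij_betw_def card_image card_subset_eq)

lemma latin_square_offset_square: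
  assumes "0 < h" "0 < b" "even b"
  shows "latin_square (2 * h * b) (offset_square h b)"
  unfolding latin_square_def
proof (intro conjI ballI)
  fix i
  have "inj_on (\<lambda>j. offset_square h b i j) {1..2 * h * b}"
  proof (rule inj_onI)
    fix j j'
    assume j: "j \<in> {1..2 * h * b}" "j' \<in> {1..2 * h * b}"
      and "offset_square h b i j = offset_square h b i j'"
    hence "j - 1 = j' - 1"
      by (intro inj_column_offset[of h b])
        (use assms in \<open>auto simp: offset_square_eq_iff cong_add_lcancel_nat\<close>)
    thus "j = j'" using j by auto
  qed
  thus "bij_betw (\<lambda>j. offset_square h b i j) {1..2 * h * b} {1..2 * h * b}"
    by (rule bij_betw_if_inj_on_card_eq)
      (use offset_square_in_range[OF assms(1,2)] in auto)
next
  fix j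
  have "inj_on (\<lambda>i. offset_square h b i j) {1..2 * h * b}"
  proof (rule inj_onI)
    fix i i'
    assume i: "i \<in> {1..2 * h * b}" "i' \<in> {1..2 * h * b}"
      and "offset_square h b i j = offset_square h b i' j"
    hence "i - 1 = i' - 1"
      by (intro inj_row_offset[of h b]) (auto simp: offset_square_eq_iff cong_add_rcancel_nat)
    thus "i = i'" using i by auto
  qed
  thus "bij_betw (\<lambda>i. offset_square h b i j) {1..2 * h * b} {1..2 * h * b}"
    by (rule bij_betw_if_inj_on_card_eq)
      (use offset_square_in_range[OF assms(1,2)] in auto)
qed

lemma div_pred_eq_if_in_interval:
  fixes i k d :: nat
  assumes "i \<in> {k * d + 1..(k + 1) * d}"
  shows "(i - 1) div d = k"
  using assms by (intro div_nat_eqI) (auto simp: mult_ac)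

lemma sudoku_latin_square_offset_square:
  assumes "0 < h" "0 < b" "even b"
  shows "sudoku_latin_square (2 * h) b (offset_square h b)"
  unfolding sudoku_latin_square_def
proof (intro conjI allI impI)
  show "latin_square (2 * h * b) (offset_square h b)"
    using assms by (rule latin_square_offset_square)
next
  fix k l
  let ?B = "{k * (2 * h) + 1..(k + 1) * (2 * h)} \<times> {l * b + 1..(l + 1) * b}"
  have "inj_on (\<lambda>(i, j). offset_square h b i j) ?B"
  proof (rule inj_onI, clarify)
    fix i j i' j'
    assume i: "i \<in> {k * (2 * h) + 1..(k + 1) * (2 * h)}"
        "i' \<in> {k * (2 * h) + 1..(k + 1) * (2 * h)}"
      and j: "j \<in> {l * b + 1..(l + 1) * b}" "j' \<in> {l * b + 1..(l + 1) * b}"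
      and eq: "offset_square h b i j = offset_square h b i' j'"
    have "i - 1 = i' - 1 \<and> j - 1 = j' - 1"
      using eq i[THEN div_pred_eq_if_in_interval] j[THEN div_pred_eq_if_in_interval] assms
      by (intro inj_offset_sum_block[of h b]) (simp_all add: offset_square_eq_iff)
    thus "i = i' \<and> j = j'" using i j by auto
  qed
  thus "bij_betw (\<lambda>(i, j). offset_square h b i j) ?B {1..2 * h * b}"
    by (rule bij_betw_if_inj_on_card_eq)
      (use offset_square_in_range[OF assms(1,2)] in auto)
qed

section \<open>Distances between neighbours\<close>

lemma cyclic_distance_commute: "cyclic_distance n u v = cyclic_distance n v u"
  by (simp add: cyclic_distance_def min.commute)

text \<open>
  In the form \<open>e \<le> d \<le> n - e\<close> the hypothesis on the step \<open>d\<close> is symmetric under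
  negation modulo \<open>n\<close>, so it bounds both residues in the definition.
\<close>

lemma cyclic_distance_ge_if_step:
  fixes X Y d e n :: nat
  assumes "[Y = X + d] (mod n)" "e \<le> d" "d + e \<le> n" "0 < e"
  shows "int e \<le> cyclic_distance n (1 + X mod n) (1 + Y mod n)"
proof -
  have Y: "int Y mod int n = (int X + int d) mod int n"
    using assms(1) by (simp add: cong_def flip: of_nat_add of_nat_mod)
  have up: "(int (1 + Y mod n) - int (1 + X mod n)) mod int n = int d"
  proof -
    have "(int (1 + Y mod n) - int (1 + X mod n)) mod int n = (int Y - int X) mod int n"
      by (simp add: of_nat_mod mod_diff_eq)
    also have "\<dots> = ((int X + int d) - int X) mod int n"
      using Y by (metis mod_diff_left_eq)
    also have "\<dots> = int d" using assms by simp
    finally show ?thesis .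
  qed
  have down: "(int (1 + X mod n) - int (1 + Y mod n)) mod int n = int n - int d"
  proof -
    have "(int (1 + X mod n) - int (1 + Y mod n)) mod int n = (int X - int Y) mod int n"
      by (simp add: of_nat_mod mod_diff_eq)
    also have "\<dots> = (int X - (int X + int d)) mod int n"
      using Y by (metis mod_diff_right_eq)
    also have "\<dots> = (int n - int d) mod int n" by simp
    also have "\<dots> = int n - int d" using assms by (intro mod_pos_pos_trivial) auto
    finally show ?thesis .
  qed
  show ?thesis unfolding cyclic_distance_def up down using assms by simp
qed

lemma Suc_div_cases: "Suc x div k = x div k \<or> Suc x div k = x div k + 1"
  by (simp add: div_Suc)

lemma row_offset_Suc:
  obtains d where "row_offset h b (Suc x) = row_offset h b x + d" "h * b \<le> d" "d \<le> h * b + 1"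
  using Suc_div_cases[of x 2] by (force simp: row_offset_def)

lemma column_offset_Suc:
  obtains d where "column_offset h b (Suc y) = column_offset h b y + d"
    "h * (b - 1) \<le> d" "d \<le> h * (b - 1) + 1"
  using Suc_div_cases[of y "2 * b"] by (force simp: column_offset_def)

lemma cyclic_distance_vertical_ge:
  assumes "0 < h" "2 \<le> b" "1 \<le> i"
  shows "int (h * (b - 1)) \<le> cyclic_distance (2 * h * b)
    (offset_square h b i j) (offset_square h b (i + 1) j)"
proof -
  obtain d where d: "row_offset h b (Suc (i - 1)) = row_offset h b (i - 1) + d"
    "h * b \<le> d" "d \<le> h * b + 1" by (rule row_offset_Suc)
  have hb: "h * b = h * (b - 1) + h" using assms(2) by (cases b) auto
  show ?thesis unfolding offset_square_def
    by (rule cyclic_distance_ge_if_step[of _ _ d]) (use d hb assms in \<open>auto simp: add_ac\<close>)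
qed

lemma cyclic_distance_horizontal_ge:
  assumes "0 < h" "2 \<le> b" "1 \<le> j"
  shows "int (h * (b - 1)) \<le> cyclic_distance (2 * h * b)
    (offset_square h b i j) (offset_square h b i (j + 1))"
proof -
  obtain d where d: "column_offset h b (Suc (j - 1)) = column_offset h b (j - 1) + d"
    "h * (b - 1) \<le> d" "d \<le> h * (b - 1) + 1" by (rule column_offset_Suc)
  have hb: "h * b = h * (b - 1) + h" using assms(2) by (cases b) auto
  show ?thesis unfolding offset_square_def
    by (rule cyclic_distance_ge_if_step[of _ _ d]) (use d hb assms in \<open>auto simp: add_ac\<close>)
qed

lemma cyclic_distance_adjacent_ge:
  assumes "0 < h" "2 \<le> b" "1 \<le> i" "1 \<le> j" "1 \<le> i'" "1 \<le> j'"
    and "adjacent_cells (i, j) (i', j')"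
  shows "int (h * (b - 1)) \<le> cyclic_distance (2 * h * b)
    (offset_square h b i j) (offset_square h b i' j')"
proof -
  consider "i' = i" "j' = j + 1" | "i' = i" "j = j' + 1"
    | "j' = j" "i' = i + 1" | "j' = j" "i = i' + 1"
    using assms(7) by (auto simp: adjacent_cells_def)
  thus ?thesis
    by cases (use assms cyclic_distance_horizontal_ge cyclic_distance_vertical_ge
      cyclic_distance_commute in metis)+
qed

section \<open>Extrema\<close>

text \<open>
  The minimum and the maximum in the definitions are informative only over finite nonempty
  sets. Both sets are finite because a cyclic distance is a residue modulo \<open>n\<close>.
\<close>

lemma cyclic_distance_in_range:
  assumes "0 < n"
  shows "cyclic_distance n u v \<in> {0..<int n}"
  using assms by (simp add: cyclic_distance_def min_less_iff_disj)

definition neighbour_distances :: "nat \<Rightarrow> (nat \<Rightarrow> nat \<Rightarrow> nat) \<Rightarrow> int set" where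
  "neighbour_distances n L = {cyclic_distance n (L i j) (L i' j') | i j i' j'.
     i \<in> {1..n} \<and> j \<in> {1..n} \<and> i' \<in> {1..n} \<and> j' \<in> {1..n} \<and>
     adjacent_cells (i, j) (i', j')}"

lemma inner_distance_eq_Min: "inner_distance n L = Min (neighbour_distances n L)"
  by (simp add: inner_distance_def neighbour_distances_def)

lemma neighbour_distances_subset:
  assumes "0 < n"
  shows "neighbour_distances n L \<subseteq> {0..<int n}"
  using cyclic_distance_in_range[OF assms] unfolding neighbour_distances_def by blast

lemma inner_distance_in_neighbour_distances:
  assumes "2 \<le> n"
  shows "inner_distance n L \<in> neighbour_distances n L"
proof -
  have "adjacent_cells (1, 1) (1, 2)" by (simp add: adjacent_cells_def)
  hence "cyclic_distance n (L 1 1) (L 1 2) \<in> neighbour_distances n L"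
    unfolding neighbour_distances_def using assms by fastforce
  moreover have "finite (neighbour_distances n L)"
    using neighbour_distances_subset[of n L] assms by (auto intro: finite_subset)
  ultimately show ?thesis unfolding inner_distance_eq_Min by (intro Min_in) auto
qed

lemma inner_distance_le_MiD:
  assumes "2 \<le> a * b" "sudoku_latin_square a b L"
  shows "inner_distance (a * b) L \<le> MiD a b"
proof -
  have "{inner_distance (a * b) L | L. sudoku_latin_square a b L} \<subseteq> {0..<int (a * b)}"
    using inner_distance_in_neighbour_distances[OF assms(1)]
      neighbour_distances_subset[of "a * b"] assms(1) by fastforce
  hence "finite {inner_distance (a * b) L | L. sudoku_latin_square a b L}"
    by (rule finite_subset) simp
  thus ?thesis unfolding MiD_def by (rule Max_ge) (use assms(2) in blast)
qed

theorem theorem4p7: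
  fixes a b n :: nat
  assumes "0 < a" and "0 < b" and "even a" and "even b" and "a \<le> b"
    and "n = a * b"
  shows "real_of_int (MiD a b) \<ge> (real n - real a) / 2"
proof -
  obtain h where a: "a = 2 * h" using assms(3) by (elim evenE)
  have h: "0 < h" using a assms(1) by simp
  have b: "2 \<le> b" using assms(2,4) by (cases b rule: parity_cases) auto
  have n: "2 \<le> 2 * h * b" using h b by (simp add: Suc_le_eq)
  let ?L = "offset_square h b"
  have "inner_distance (2 * h * b) ?L \<in> neighbour_distances (2 * h * b) ?L"
    using n by (rule inner_distance_in_neighbour_distances)
  hence "int (h * (b - 1)) \<le> inner_distance (2 * h * b) ?L"
    unfolding neighbour_distances_def using cyclic_distance_adjacent_ge[OF h b] by auto
  also have "\<dots> \<le> MiD a b"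
    unfolding a using n sudoku_latin_square_offset_square[OF h assms(2,4)]
    by (rule inner_distance_le_MiD)
  finally have "real (h * (b - 1)) \<le> real_of_int (MiD a b)" by linarith
  moreover have "real (h * (b - 1)) = (real n - real a) / 2"
    using assms(2) by (simp add: a assms(6) algebra_simps)
  ultimately show ?thesis by simp
qed

end
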